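(* Let $\pi\in\Pi_{\mathsf a}$ and suppose $J_\pi$ is radially unbounded. Let $\pi'$ be given by $\pi'(x)=u_*(x,\nabla v_\pi(x))$ for $x\in\mathcal X$. Then $\pi'\in\Pi_{\mathsf a}$ and $J_{\pi'}(x)\le J_\pi(x)$ for all $x\in\mathcal X$.
   Context: Nonlinear optimal control setting. State space $\mathcal X=\mathbb R^l$, $\mathcal X^{\mathsf T}=\mathbb R^{1\times l}$, time space $\mathbb T=[0,\infty)$; the action space $\mathcal U\subseteq\mathbb R^m$ (a set $O\cup\partial O$ or $O$ with $O$ open in $\mathbb R^m$) contains $0$. The system is $\dot X_t=f(X_t,U_t)$ with $f:\mathcal X\times\mathcal U\to\mathcal X$ locally Lipschitz and $f(0,0)=0$. The cost function $c:\mathcal X\times\mathcal U\to\mathbb R$ is continuous and positive definite: $c(0,0)=0$ and $c(x,u)>0$ for $(x,u)\ne(0,0)$; the reward is $r=-c$, and $C_t=c(X_t,U_t)$. $\gamma\in(0,1]$ is the discount factor, $\alpha=-\ln\gamma\ge0$. The Hamiltonian is $h(x,u,p)=r(x,u)+p\,f(x,u)$ (gradients are row vectors), and it is assumed there is a locally Lipschitz $u_*:\mathcal X\times\mathcal X^{\mathsf T}\to\mathcal U$ with $u_*(x,p)\in\arg\max_{u\in\mathcal U}h(x,u,p)$ for all $(x,p)$; this $u_*$ is fixed. A policy is a continuous function $\pi:\mathcal X\to\mathcal U$; write $f_\pi(x)=f(x,\pi(x))$, $c_\pi(x)=c(x,\pi(x))$. $\Pi_0$ is the set of locally Lipschitz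 policies with $\pi(0)=0$. For a locally Lipschitz policy $\pi$ and $x\in\mathcal X$, $[0,t_{\mathsf{max}}(x;\pi))$ with $t_{\mathsf{max}}(x;\pi)\in(0,\infty]$ is the maximal forward existence interval of the unique solution of $\dot X_t=f_\pi(X_t)$, $X_0=x$ (global existence is not assumed); $\mathbb G_\pi^x[Y]$ denotes the value of $Y$ along that solution with $U_t=\pi(X_t)$. The cost value function is $J_\pi(x)=\mathbb G_\pi^x[\int_0^\infty\gamma^tC_t\,dt]\in[0,\infty]$ if $t_{\mathsf{max}}(x;\pi)=\infty$ and $J_\pi(x)=\infty$ otherwise; $v_\pi=-J_\pi$. $\Pi_{\mathsf a}=\{\pi\in\Pi_0: J_\pi(x)<\infty\ \forall x\in\mathcal X\}$ (assumed nonempty). Standing assumptions: for every $\pi\in\Pi_{\mathsf a}$, $v_\pi$ is $\mathrm C^1$ with locally Lipschitz gradient; for every $\pi\in\Pi_0$, $c_\pi$ is radially nonvanishing, i.e., $\inf_{\|x\|\ge\rho}|c_\pi(x)|\not\to0$ as $\rho\to\infty$. A function $g:\mathcal X\to\mathbb R$ is radially unbounded iff $\inf_{\|x\|\ge\rho}|g(x)|\to\infty$ as $\rho\to\infty$. *)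

theory Defs
  imports "HOL-Analysis.Analysis"
begin

definition locally_lipschitz_on ::
  "'a::metric_space set \<Rightarrow> ('a \<Rightarrow> 'b::metric_space) \<Rightarrow> bool" where
  "locally_lipschitz_on S g \<longleftrightarrow>
     (\<forall>x\<in>S. \<exists>e>0. \<exists>L. lipschitz_on L (cball x e \<inter> S) g)"

(* Row vectors are identified with elements of the same Euclidean space, so that the product
   p f of a row and a column vector is the inner product, and gradients are ordinary vectors. *)
definition gradient :: "('a::real_inner \<Rightarrow> real) \<Rightarrow> 'a \<Rightarrow> 'a" where
  "gradient v x = (THE D. GDERIV v x :> D)"

definition C1_lipschitz_gradient :: "('a::real_inner \<Rightarrow> real) \<Rightarrow> bool" where
  "C1_lipschitz_gradient v \<longleftrightarrow>
     (\<forall>x. v differentiable (at x)) \<and> continuous_on UNIV (gradient v) \<and>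
     locally_lipschitz_on UNIV (gradient v)"

definition radially_nonvanishing :: "('a::real_normed_vector \<Rightarrow> real) \<Rightarrow> bool" where
  "radially_nonvanishing g \<longleftrightarrow> \<not> ((\<lambda>\<rho>. INF x\<in>{x. norm x \<ge> \<rho>}. \<bar>g x\<bar>) \<longlongrightarrow> 0) at_top"

definition radially_unbounded :: "('a::real_normed_vector \<Rightarrow> real) \<Rightarrow> bool" where
  "radially_unbounded g \<longleftrightarrow> filterlim (\<lambda>\<rho>. INF x\<in>{x. norm x \<ge> \<rho>}. \<bar>g x\<bar>) at_top at_top"

definition solves_ode_until ::
  "('a::real_normed_vector \<Rightarrow> 'a) \<Rightarrow> 'a \<Rightarrow> ereal \<Rightarrow> (real \<Rightarrow> 'a) \<Rightarrow> bool" where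
  "solves_ode_until F x T X \<longleftrightarrow>
     X 0 = x \<and>
     (\<forall>t\<in>{t. 0 \<le> t \<and> ereal t < T}.
        (X has_vector_derivative F (X t)) (at t within {t. 0 \<le> t \<and> ereal t < T}))"

definition t_max :: "('a::real_normed_vector \<Rightarrow> 'a) \<Rightarrow> 'a \<Rightarrow> ereal" where
  "t_max F x = Sup {T. 0 < T \<and> (\<exists>X. solves_ode_until F x T X)}"

(* SOME and not THE, because a solution is unique only on the interval from 0 to t_max,
   while X is a function on all of real. *)
definition trajectory :: "('a::real_normed_vector \<Rightarrow> 'a) \<Rightarrow> 'a \<Rightarrow> real \<Rightarrow> 'a" where
  "trajectory F x = (SOME X. solves_ode_until F x (t_max F x) X)"

definition hamiltonian ::
  "('x::real_inner \<Rightarrow> 'u \<Rightarrow> 'x) \<Rightarrow> ('x \<Rightarrow> 'u \<Rightarrow> real) \<Rightarrow> 'x \<Rightarrow> 'u \<Rightarrow> 'x \<Rightarrow> real" where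
  "hamiltonian f c x u p = - c x u + p \<bullet> f x u"

definition policies :: "'u::topological_space set \<Rightarrow> ('x::topological_space \<Rightarrow> 'u) set" where
  "policies U = {\<pi>. continuous_on UNIV \<pi> \<and> range \<pi> \<subseteq> U}"

definition policies0 ::
  "'u::{metric_space,zero} set \<Rightarrow> ('x::{metric_space,zero} \<Rightarrow> 'u) set" where
  "policies0 U = {\<pi> \<in> policies U. locally_lipschitz_on UNIV \<pi> \<and> \<pi> 0 = 0}"

definition cost_value ::
  "('x::real_normed_vector \<Rightarrow> 'u \<Rightarrow> 'x) \<Rightarrow> ('x \<Rightarrow> 'u \<Rightarrow> real) \<Rightarrow> real \<Rightarrow>
   ('x \<Rightarrow> 'u) \<Rightarrow> 'x \<Rightarrow> ennreal" where
  "cost_value f c \<gamma> \<pi> x =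
     (let F = (\<lambda>y. f y (\<pi> y)); X = trajectory F x in
      if t_max F x = \<infinity>
      then \<integral>\<^sup>+t\<in>{0..}. ennreal (\<gamma> powr t * c (X t) (\<pi> (X t))) \<partial>lborel
      else \<infinity>)"

(* Real-valued, hence meaningful only where the cost is finite, as it is everywhere
   for admissible policies. *)
definition value_fun ::
  "('x::real_normed_vector \<Rightarrow> 'u \<Rightarrow> 'x) \<Rightarrow> ('x \<Rightarrow> 'u \<Rightarrow> real) \<Rightarrow> real \<Rightarrow>
   ('x \<Rightarrow> 'u) \<Rightarrow> 'x \<Rightarrow> real" where
  "value_fun f c \<gamma> \<pi> x = - enn2real (cost_value f c \<gamma> \<pi> x)"

definition admissible ::
  "'u::{metric_space,zero} set \<Rightarrow> ('x::real_normed_vector \<Rightarrow> 'u \<Rightarrow> 'x) \<Rightarrow>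
   ('x \<Rightarrow> 'u \<Rightarrow> real) \<Rightarrow> real \<Rightarrow> ('x \<Rightarrow> 'u) set" where
  "admissible U f c \<gamma> = {\<pi> \<in> policies0 U. \<forall>x. cost_value f c \<gamma> \<pi> x < \<infinity>}"

end

theory Submission
  imports Defs
begin

text \<open>
  Writing J for the cost of the policy \<open>\<pi>\<close> and \<open>F\<close> for its closed loop, uniqueness of trajectories
  makes \<open>\<gamma>\<^sup>t J(X\<^sub>t)\<close> plus the cost accumulated up to \<open>t\<close> constant along \<open>\<pi>\<close>; differentiating at \<open>t = 0\<close>
  gives \<open>ln \<gamma> J + \<nabla>J F + c\<^sub>\<pi> = 0\<close>. As \<open>\<pi>'\<close> maximises the Hamiltonian, the left-hand side with \<open>\<pi>'\<close> in place
  of \<open>\<pi>\<close> is nonpositive, so the same sum is nonincreasing along \<open>\<pi>'\<close>. Hence J stays bounded on bounded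
  time intervals, radial unboundedness excludes blow-up, and the cost of \<open>\<pi>'\<close> is at most J.

  Solutions are constructed globally for the vector field composed with the projection onto a
  large ball; they solve the original equation as long as they stay in that ball, which the bound
  on J guarantees on any prescribed time interval. This avoids maximal solutions.
\<close>

subsection \<open>Locally Lipschitz functions\<close>

text \<open>The library notion \<open>local_lipschitz\<close> carries a time parameter. A constant
  family over the one-point time set \<open>{0}\<close> translates
  \<open>locally_lipschitz_on\<close> into it.\<close>

lemma locally_lipschitz_on_imp_continuous_on:
  assumes "locally_lipschitz_on S g"
  shows "continuous_on S g"
proof -
  have "local_lipschitz {0::real} S (\<lambda>_. g)"
    using assms unfolding locally_lipschitz_on_def local_lipschitz_def by blast
  then show ?thesis
    by (rule local_lipschitz_continuous_on) simp
qed

lemma locally_lipschitz_on_compact: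
  assumes "locally_lipschitz_on S g" "compact K" "K \<subseteq> S"
  obtains L where "lipschitz_on L K g"
proof -
  have "local_lipschitz {0::real} S (\<lambda>_. g)"
    using assms(1) unfolding locally_lipschitz_on_def local_lipschitz_def by blast
  then have "local_lipschitz {0::real} K (\<lambda>_. g)"
    by (rule local_lipschitz_subset) (use assms(3) in auto)
  then obtain L where "\<And>t. t \<in> {0::real} \<Longrightarrow> lipschitz_on L K g"
    using assms(2) by (elim local_lipschitz_compact_implies_lipschitz) auto
  with that show thesis by blast
qed

text \<open>By continuity of \<open>g\<close>, a small enough ball around \<open>x\<close> is mapped
  into the ball around \<open>g x\<close> on which \<open>h\<close> is Lipschitz; there the two
  constants multiply.\<close>

lemma locally_lipschitz_on_compose:
  assumes g: "locally_lipschitz_on S g" and h: "locally_lipschitz_on T h" and "g ` S \<subseteq> T"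
  shows "locally_lipschitz_on S (\<lambda>x. h (g x))"
  unfolding locally_lipschitz_on_def
proof
  fix x assume x: "x \<in> S"
  obtain e L where e: "e > 0" "lipschitz_on L (cball x e \<inter> S) g"
    using g x unfolding locally_lipschitz_on_def by blast
  obtain d M where d: "d > 0" "lipschitz_on M (cball (g x) d \<inter> T) h"
    using h x assms(3) unfolding locally_lipschitz_on_def by blast
  have "continuous (at x within S) g"
    using locally_lipschitz_on_imp_continuous_on[OF g] x
    by (simp add: continuous_on_eq_continuous_within)
  then obtain k where k: "k > 0" "\<And>y. y \<in> S \<Longrightarrow> dist y x < k \<Longrightarrow> dist (g y) (g x) < d"
    using d(1) unfolding continuous_within_eps_delta by blast
  define r where "r = min e (k / 2)"
  have "r > 0" "r \<le> e" "r < k" using e k by (auto simp: r_def)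
  have "lipschitz_on L (cball x r \<inter> S) g"
    using e(2) by (rule lipschitz_on_subset) (use \<open>r \<le> e\<close> in auto)
  moreover have "lipschitz_on M (g ` (cball x r \<inter> S)) h"
    using d(2)
  proof (rule lipschitz_on_subset)
    show "g ` (cball x r \<inter> S) \<subseteq> cball (g x) d \<inter> T"
    proof
      fix z assume "z \<in> g ` (cball x r \<inter> S)"
      then obtain y where y: "z = g y" "y \<in> S" "dist x y \<le> r" by auto
      then have "dist y x < k" using \<open>r < k\<close> by (simp add: dist_commute)
      then have "dist z (g x) < d" using k(2) y by simp
      then show "z \<in> cball (g x) d \<inter> T"
        using y assms(3) by (auto simp: dist_commute)
    qed
  qed
  ultimately have "lipschitz_on (M * L) (cball x r \<inter> S) (\<lambda>x. h (g x))"
    by (rule lipschitz_on_compose2)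
  with \<open>r > 0\<close> show "\<exists>e>0. \<exists>L. lipschitz_on L (cball x e \<inter> S) (\<lambda>x. h (g x))" by blast
qed

text \<open>The regularity of \<open>f\<close>, \<open>c\<close> and \<open>ustar\<close> is joint
  in both arguments. A closed loop is then a composition with the graph of the policy, and the
  improved policy a composition with the graph of the gradient.\<close>

lemma locally_lipschitz_on_graph:
  assumes "locally_lipschitz_on S g"
  shows "locally_lipschitz_on S (\<lambda>x. (x, g x))"
  unfolding locally_lipschitz_on_def
proof
  fix x assume "x \<in> S"
  then obtain e L where e: "e > 0" "lipschitz_on L (cball x e \<inter> S) g"
    using assms unfolding locally_lipschitz_on_def by blast
  then show "\<exists>e>0. \<exists>L. lipschitz_on L (cball x e \<inter> S) (\<lambda>x. (x, g x))"
    using lipschitz_on_Pair[OF lipschitz_on_id e(2)] by blast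
qed

subsection \<open>Existence and uniqueness of solutions\<close>

lemma integral_has_vector_derivative_atLeast:
  fixes h :: "real \<Rightarrow> 'a::banach"
  assumes "continuous_on {0..} h" "0 \<le> t"
  shows "((\<lambda>u. integral {0..u} h) has_vector_derivative h t) (at t within {0..})"
proof -
  have "((\<lambda>u. integral {0..u} h) has_vector_derivative h t) (at t within {0..t+1})"
    by (rule integral_has_vector_derivative)
      (use assms in \<open>auto intro: continuous_on_subset\<close>)
  moreover have "at t within {0..t+1} = at t within {0..}"
    by (rule at_within_nhd[where S = "{..<t+1}"]) auto
  ultimately show ?thesis by simp
qed

lemma continuous_on_integral_atLeast:
  fixes h :: "real \<Rightarrow> 'a::banach"
  assumes "continuous_on {0..} h"
  shows "continuous_on {0..} (\<lambda>u. integral {0..u} h)"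
  unfolding continuous_on_eq_continuous_within
  using has_vector_derivative_continuous[OF integral_has_vector_derivative_atLeast[OF assms]]
  by auto

lemma has_integral_exp_Icc:
  assumes "K > 0" "t \<ge> 0"
  shows "((\<lambda>s. C * exp (K * s)) has_integral C * (exp (K * t) - 1) / K) {0..t::real}"
proof -
  have "((\<lambda>s. C * exp (K * s)) has_integral C * exp (K * t) / K - C * exp (K * 0) / K) {0..t}"
    by (rule fundamental_theorem_of_calculus[OF assms(2)])
      (use assms in \<open>auto intro!: derivative_eq_intros
        simp flip: has_real_derivative_iff_has_vector_derivative\<close>)
  then show ?thesis by (simp add: right_diff_distrib diff_divide_distrib)
qed

text \<open>Picard iteration for the weighted function \<open>exp (- K t) *\<^sub>R Y t\<close>: the weight makes it a
  contraction on the whole half-line, so no local solutions have to be concatenated.\<close>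

lemma global_solution_bounded_lipschitz:
  fixes G :: "'a::euclidean_space \<Rightarrow> 'a"
  assumes lip: "lipschitz_on L UNIV G" and bd: "\<And>y. norm (G y) \<le> M"
  obtains Y where "Y 0 = x"
    "\<And>t. t \<ge> 0 \<Longrightarrow> (Y has_vector_derivative G (Y t)) (at t within {0..})"
proof -
  \<comment> \<open>This choice brings the contraction factor \<open>L / K\<close> below
    \<open>1 / 2\<close> and keeps \<open>K\<close> positive even for \<open>L = 0\<close>.\<close>
  define K where "K = 2 * L + 1"
  have "L \<ge> 0" using lip by (rule lipschitz_on_nonneg)
  then have K: "K > 0" "L / K \<le> 1 / 2" by (auto simp: K_def field_simps)
  have "M \<ge> 0" using bd[of 0] norm_ge_zero order_trans by blast
  have G_cont: "continuous_on UNIV G" using lip by (rule lipschitz_on_continuous_on)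
  have cont: "continuous_on S (\<lambda>s. G (exp (K * s) *\<^sub>R apply_bcontfun z s))" for z S
    by (intro continuous_on_compose2[OF G_cont] continuous_intros) auto
  \<comment> \<open>The Picard operator expressed for the weighted function. Bounded continuous
    functions live on all of the real line, so \<open>max 0 t\<close> extends the image by the
    constant \<open>x\<close> to negative times.\<close>
  define \<Psi> where "\<Psi> z (t::real) = exp (- (K * max 0 t)) *\<^sub>R
    (x + integral {0..max 0 t} (\<lambda>s. G (exp (K * s) *\<^sub>R apply_bcontfun z s)))" for z t
  \<comment> \<open>Since \<open>G\<close> is bounded, the integral grows at most linearly, and the
    weight absorbs this through \<open>K * s \<le> exp (K * s)\<close>.\<close>
  have \<Psi>: "\<Psi> z \<in> bcontfun" for z
  proof (rule bcontfun_normI)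
    show "continuous_on UNIV (\<Psi> z)"
      unfolding \<Psi>_def
      by (intro continuous_intros continuous_on_compose2[OF continuous_on_integral_atLeast[OF cont]])
        (simp_all add: image_subset_iff le_max_iff_disj)
    fix t :: real
    define s where "s = max 0 t"
    have s: "s \<ge> 0" by (simp add: s_def)
    have "norm (integral {0..s} (\<lambda>s. G (exp (K * s) *\<^sub>R apply_bcontfun z s))) \<le> M * s"
      using integral_bound[OF s cont, of z M] bd by simp
    then have "norm (\<Psi> z t) \<le> exp (- (K * s)) * (norm x + M * s)"
      unfolding \<Psi>_def s_def[symmetric] norm_scaleR abs_exp_cancel
      by (intro mult_left_mono norm_triangle_le) auto
    also have "M * s \<le> M * (exp (K * s) / K)"
    proof (rule mult_left_mono[OF _ \<open>M \<ge> 0\<close>])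
      have "K * s \<le> exp (K * s)" using exp_ge_add_one_self[of "K * s"] by linarith
      then show "s \<le> exp (K * s) / K" using K(1) by (simp add: pos_le_divide_eq mult.commute)
    qed
    also have "exp (- (K * s)) * (norm x + M * (exp (K * s) / K)) = exp (- (K * s)) * norm x + M / K"
      by (simp add: algebra_simps exp_minus field_simps)
    also have "\<dots> \<le> norm x + M / K"
      using s K by (simp add: mult_left_le_one_le)
    finally show "norm (\<Psi> z t) \<le> norm x + M / K" by simp
  qed
  have "\<exists>!z. Bcontfun (\<Psi> z) = z"
  proof (rule banach_fix_type[of "1 / 2"]; (intro allI)?)
    fix z w :: "real \<Rightarrow>\<^sub>C 'a"
    show "dist (Bcontfun (\<Psi> z)) (Bcontfun (\<Psi> w)) \<le> 1 / 2 * dist z w"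
    proof (rule dist_bound)
      fix t :: real
      define s where "s = max 0 t"
      have s: "s \<ge> 0" by (simp add: s_def)
      define D where "D = dist z w"
      have D: "D \<ge> 0" by (simp add: D_def)
      let ?g = "\<lambda>z s. G (exp (K * s) *\<^sub>R apply_bcontfun z s)"
      have int: "?g z integrable_on {0..s}" for z
        by (rule integrable_continuous_real[OF cont])
      \<comment> \<open>Undoing the weight costs a factor \<open>exp (K * r)\<close>. Integrating it
        gains \<open>1 / K\<close>, and the weight in front of the integral cancels the remaining
        exponential, so only \<open>L / K\<close> survives.\<close>
      have "norm (?g z r - ?g w r) \<le> L * D * exp (K * r)" for r
      proof -
        have "norm (?g z r - ?g w r) \<le>
            L * norm (exp (K * r) *\<^sub>R apply_bcontfun z r - exp (K * r) *\<^sub>R apply_bcontfun w r)"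
          by (rule lipschitz_on_normD[OF lip]) auto
        also have "\<dots> = L * (exp (K * r) * dist (apply_bcontfun z r) (apply_bcontfun w r))"
          by (simp add: dist_norm flip: scaleR_right_diff_distrib)
        also have "\<dots> \<le> L * (exp (K * r) * D)"
          using \<open>L \<ge> 0\<close> unfolding D_def by (intro mult_left_mono dist_bounded) auto
        finally show ?thesis by (simp add: algebra_simps)
      qed
      then have "norm (integral {0..s} (\<lambda>r. ?g z r - ?g w r)) \<le>
          integral {0..s} (\<lambda>r. L * D * exp (K * r))"
        by (intro integral_norm_bound_integral integrable_diff int
            has_integral_integrable[OF has_integral_exp_Icc[OF K(1) s]])
      also have "\<dots> = L * D * (exp (K * s) - 1) / K"
        by (rule integral_unique[OF has_integral_exp_Icc[OF K(1) s]])
      also have "\<dots> \<le> L * D * exp (K * s) / K"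
        using K \<open>L \<ge> 0\<close> D by (intro divide_right_mono mult_left_mono) auto
      also have "\<dots> = (L / K) * (D * exp (K * s))" by simp
      also have "\<dots> \<le> 1 / 2 * (D * exp (K * s))"
        using K D by (intro mult_right_mono) auto
      finally have *: "norm (integral {0..s} (?g z) - integral {0..s} (?g w)) \<le> 1 / 2 * (D * exp (K * s))"
        by (simp add: integral_diff int)
      have "dist (\<Psi> z t) (\<Psi> w t) =
          exp (- (K * s)) * norm (integral {0..s} (?g z) - integral {0..s} (?g w))"
        unfolding \<Psi>_def s_def[symmetric] dist_norm
        by (simp flip: scaleR_right_diff_distrib)
      also have "\<dots> \<le> exp (- (K * s)) * (1 / 2 * (D * exp (K * s)))"
        using * by (rule mult_left_mono) simp
      also have "\<dots> = 1 / 2 * D" by (simp add: exp_minus field_simps)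
      finally show "dist (apply_bcontfun (Bcontfun (\<Psi> z)) t) (apply_bcontfun (Bcontfun (\<Psi> w)) t)
          \<le> 1 / 2 * dist z w"
        using \<Psi> by (simp add: Bcontfun_inverse D_def)
    qed
  qed auto
  then obtain z where "Bcontfun (\<Psi> z) = z" by blast
  then have z: "apply_bcontfun z t = \<Psi> z t" for t
    using Bcontfun_inverse[OF \<Psi>, of z] by simp
  \<comment> \<open>Removing the weight turns the fixed point into a solution of the integral
    equation.\<close>
  define Y where "Y t = exp (K * t) *\<^sub>R apply_bcontfun z t" for t
  have Y: "Y t = x + integral {0..t} (\<lambda>s. G (Y s))" if "t \<ge> 0" for t
    using that unfolding Y_def z[of t] \<Psi>_def by (simp add: exp_minus max_absorb2)
  have "(Y has_vector_derivative G (Y t)) (at t within {0..})" if "t \<ge> 0" for t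
  proof (rule has_vector_derivative_transform[where f = "\<lambda>t. x + integral {0..t} (\<lambda>s. G (Y s))"])
    have "((\<lambda>t. integral {0..t} (\<lambda>s. G (Y s))) has_vector_derivative G (Y t)) (at t within {0..})"
      by (rule integral_has_vector_derivative_atLeast) (use cont that in \<open>auto simp: Y_def\<close>)
    then show "((\<lambda>t. x + integral {0..t} (\<lambda>s. G (Y s))) has_vector_derivative G (Y t)) (at t within {0..})"
      by (auto intro!: derivative_eq_intros)
  qed (use that Y in auto)
  moreover have "Y 0 = x" using Y[of 0] by simp
  ultimately show thesis using that by blast
qed

text \<open>Projection onto a closed ball is nonexpansive, so composing \<open>F\<close> with it
  gives a bounded, globally Lipschitz field. The projection fixes the ball, hence the curve obeys
  the original equation at every time it lies there.\<close>

lemma truncated_solution: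
  fixes F :: "'a::euclidean_space \<Rightarrow> 'a"
  assumes "locally_lipschitz_on UNIV F" "R > 0"
  obtains Y where "Y 0 = x" "continuous_on {0..} Y"
    "\<And>t. t \<ge> 0 \<Longrightarrow> norm (Y t) \<le> R \<Longrightarrow> (Y has_vector_derivative F (Y t)) (at t within {0..})"
proof -
  let ?B = "cball (0::'a) R"
  let ?p = "closest_point ?B"
  have B: "?B \<noteq> {}" "closed ?B" "convex ?B" using assms(2) by auto
  have p: "?p y \<in> ?B" for y using B by (intro closest_point_in_set)
  obtain L where L: "lipschitz_on L ?B F"
    using locally_lipschitz_on_compact[OF assms(1)] by (metis compact_cball top_greatest)
  have "lipschitz_on 1 UNIV ?p"
    using closest_point_lipschitz[OF B(3,2,1)] by (intro lipschitz_onI) auto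
  moreover have "lipschitz_on L (range ?p) F"
    using L by (rule lipschitz_on_subset) (use p in auto)
  ultimately have lip: "lipschitz_on (L * 1) UNIV (\<lambda>y. F (?p y))"
    by (rule lipschitz_on_compose2)
  have "bounded (F ` ?B)"
    by (intro compact_imp_bounded compact_continuous_image lipschitz_on_continuous_on[OF L] compact_cball)
  then obtain M where M: "\<And>y. y \<in> ?B \<Longrightarrow> norm (F y) \<le> M"
    unfolding bounded_iff by blast
  obtain Y where Y: "Y 0 = x"
    "\<And>t. t \<ge> 0 \<Longrightarrow> (Y has_vector_derivative F (?p (Y t))) (at t within {0..})"
    using global_solution_bounded_lipschitz[OF lip M[OF p]] by blast
  show thesis
  proof (rule that)
    show "Y 0 = x" by (rule Y(1))
    show "continuous_on {0..} Y"
      unfolding continuous_on_eq_continuous_within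
      using has_vector_derivative_continuous[OF Y(2)] by auto
    show "(Y has_vector_derivative F (Y t)) (at t within {0..})" if "t \<ge> 0" "norm (Y t) \<le> R" for t
      using Y(2)[OF that(1)] that(2) by (simp add: closest_point_self)
  qed
qed

section \<open>Uniqueness of solutions and the trajectory on the whole half-line\<close>

lemma solves_ode_until_at:
  assumes "solves_ode_until F x T X" "0 < t" "ereal t < T"
  shows "(X has_vector_derivative F (X t)) (at t)"
proof -
  obtain s where s: "t < s" "ereal s \<le> T"
    using ereal_dense2[OF assms(3)] by (auto simp: less_imp_le)
  have "(X has_vector_derivative F (X t)) (at t within {0<..<s})"
  proof (rule has_vector_derivative_within_subset)
    show "(X has_vector_derivative F (X t)) (at t within {t. 0 \<le> t \<and> ereal t < T})"
      using assms unfolding solves_ode_until_def by auto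
    show "{0<..<s} \<subseteq> {t. 0 \<le> t \<and> ereal t < T}"
      using s(2) by (auto intro: less_le_trans[of _ "ereal s"])
  qed
  moreover have "at t within {0<..<s} = at t"
    by (rule at_within_open) (use assms(2) s(1) in auto)
  ultimately show ?thesis by simp
qed

lemma solves_ode_until_continuous_on:
  assumes "solves_ode_until F x T X"
  shows "continuous_on {t. 0 \<le> t \<and> ereal t < T} X"
  unfolding continuous_on_eq_continuous_within
proof
  fix t assume "t \<in> {t. 0 \<le> t \<and> ereal t < T}"
  then have "(X has_vector_derivative F (X t)) (at t within {t. 0 \<le> t \<and> ereal t < T})"
    using assms unfolding solves_ode_until_def by blast
  then show "continuous (at t within {t. 0 \<le> t \<and> ereal t < T}) X"
    by (rule has_vector_derivative_continuous)
qed

lemma solves_ode_until_mono: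
  assumes "solves_ode_until F x T X" "S \<le> T"
  shows "solves_ode_until F x S X"
  unfolding solves_ode_until_def
proof (intro conjI ballI)
  show "X 0 = x" using assms(1) by (simp add: solves_ode_until_def)
  fix t assume t: "t \<in> {t. 0 \<le> t \<and> ereal t < S}"
  have sub: "{t. 0 \<le> t \<and> ereal t < S} \<subseteq> {t. 0 \<le> t \<and> ereal t < T}"
    using assms(2) less_le_trans by blast
  have "(X has_vector_derivative F (X t)) (at t within {t. 0 \<le> t \<and> ereal t < T})"
    using assms(1) t sub unfolding solves_ode_until_def by blast
  then show "(X has_vector_derivative F (X t)) (at t within {t. 0 \<le> t \<and> ereal t < S})"
    by (rule has_vector_derivative_within_subset[OF _ sub])
qed

text \<open>A Gronwall argument: with \<open>L\<close> a Lipschitz constant of \<open>F\<close> on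
  the compact set swept by both curves, the squared distance weighted by
  \<open>exp (- 2 * L * s)\<close> is nonincreasing and starts at zero.\<close>

lemma solves_ode_until_unique:
  fixes F :: "'a::euclidean_space \<Rightarrow> 'a"
  assumes "locally_lipschitz_on UNIV F"
    and X: "solves_ode_until F x T X" and Y: "solves_ode_until F x T Y"
    and t: "0 \<le> t" "ereal t < T"
  shows "X t = Y t"
proof -
  have sub: "{0..t} \<subseteq> {t. 0 \<le> t \<and> ereal t < T}"
    using t by (auto intro: le_less_trans[of _ "ereal t"])
  note cX = continuous_on_subset[OF solves_ode_until_continuous_on[OF X] sub]
  note cY = continuous_on_subset[OF solves_ode_until_continuous_on[OF Y] sub]
  have "compact (X ` {0..t} \<union> Y ` {0..t})"
    using cX cY by (intro compact_Un compact_continuous_image) auto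
  then obtain L where L: "lipschitz_on L (X ` {0..t} \<union> Y ` {0..t}) F"
    using locally_lipschitz_on_compact[OF assms(1)] by blast
  define \<phi> where "\<phi> s = exp (- 2 * L * s) * ((X s - Y s) \<bullet> (X s - Y s))" for s
  have "\<phi> 0 \<ge> \<phi> t"
  proof (rule DERIV_nonpos_imp_decreasing_open[OF t(1)])
    show "continuous_on {0..t} \<phi>"
      unfolding \<phi>_def by (intro continuous_intros cX cY)
    fix s assume s: "0 < s" "s < t"
    then have "ereal s < T" using t(2) by (metis ereal_less_eq(3) le_less_trans less_imp_le)
    note dX = solves_ode_until_at[OF X s(1) this] and dY = solves_ode_until_at[OF Y s(1) this]
    let ?d = "X s - Y s" and ?e = "F (X s) - F (Y s)"
    have "(\<phi> has_real_derivative exp (- 2 * L * s) * (2 * (?d \<bullet> ?e)) -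
        2 * L * exp (- 2 * L * s) * (?d \<bullet> ?d)) (at s)"
      using dX dY unfolding \<phi>_def has_vector_derivative_def has_field_derivative_def
      by (auto intro!: derivative_eq_intros simp: fun_eq_iff inner_commute algebra_simps)
    moreover have "?d \<bullet> ?e \<le> L * (?d \<bullet> ?d)"
    proof -
      have "norm ?e \<le> L * norm ?d"
        by (rule lipschitz_on_normD[OF L]) (use s in auto)
      then have "?d \<bullet> ?e \<le> norm ?d * (L * norm ?d)"
        by (intro order_trans[OF norm_cauchy_schwarz] mult_left_mono) auto
      then show ?thesis
        unfolding dot_square_norm power2_eq_square by (simp only: ac_simps)
    qed
    then have "exp (- 2 * L * s) * (?d \<bullet> ?e) \<le> exp (- 2 * L * s) * (L * (?d \<bullet> ?d))"
      by (rule mult_left_mono) simp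
    then have "exp (- 2 * L * s) * (2 * (?d \<bullet> ?e)) - 2 * L * exp (- 2 * L * s) * (?d \<bullet> ?d) \<le> 0"
      by (simp only: ac_simps diff_le_0_iff_le)
    ultimately show "\<exists>y. DERIV \<phi> s :> y \<and> y \<le> 0" by blast
  qed
  moreover have "\<phi> 0 = 0"
    using X Y unfolding \<phi>_def solves_ode_until_def by simp
  ultimately have "(X t - Y t) \<bullet> (X t - Y t) \<le> 0"
    unfolding \<phi>_def by (simp add: mult_le_0_iff)
  then show ?thesis by (metis inner_ge_zero inner_eq_zero_iff order_antisym right_minus_eq)
qed

text \<open>Being a supremum, \<open>t_max\<close> need not come with one solution reaching it.
  Solutions on bounded intervals agree by uniqueness and are glued together, which justifies the
  choice made in \<open>trajectory\<close>.\<close>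

lemma solves_ode_until_trajectory:
  fixes F :: "'a::euclidean_space \<Rightarrow> 'a"
  assumes lip: "locally_lipschitz_on UNIV F" and "t_max F x = \<infinity>"
  shows "solves_ode_until F x \<infinity> (trajectory F x)"
proof -
  have "\<exists>X. solves_ode_until F x (ereal (real n)) X" for n
  proof -
    have "ereal (real n) < Sup {T. 0 < T \<and> (\<exists>X. solves_ode_until F x T X)}"
      using assms(2) unfolding t_max_def by simp
    then show ?thesis
      unfolding less_Sup_iff using solves_ode_until_mono less_imp_le by blast
  qed
  then obtain X where X: "\<And>n. solves_ode_until F x (ereal (real n)) (X n)" by metis
  \<comment> \<open>The successor makes the horizon strictly larger than \<open>t\<close>, as
    solution intervals are open on the right.\<close>
  define Z where "Z t = X (Suc (nat \<lceil>t\<rceil>)) t" for t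
  have Z: "Z t = X n t" if "0 \<le> t" "t < real n" for t n
  proof -
    let ?m = "Suc (nat \<lceil>t\<rceil>)"
    have "t < real ?m" using that(1) by linarith
    define k where "k = min n ?m"
    have "solves_ode_until F x (ereal (real k)) (X n)" "solves_ode_until F x (ereal (real k)) (X ?m)"
      by (auto intro!: solves_ode_until_mono[OF X] simp: k_def)
    then show ?thesis
      unfolding Z_def
      by (intro solves_ode_until_unique[OF lip, of x "ereal (real k)", symmetric])
        (use that \<open>t < real ?m\<close> in \<open>auto simp: k_def\<close>)
  qed
  have "solves_ode_until F x \<infinity> Z"
    unfolding solves_ode_until_def
  proof (intro conjI ballI)
    show "Z 0 = x" using Z[of 0 1] X[of 1] by (simp add: solves_ode_until_def)
    fix t assume "t \<in> {t. 0 \<le> t \<and> ereal t < \<infinity>}"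
    then have t: "0 \<le> t" by simp
    obtain n where n: "t < real n" using reals_Archimedean2 by blast
    have "(X n has_vector_derivative F (X n t)) (at t within {t. 0 \<le> t \<and> ereal t < ereal (real n)})"
      using X[of n] t n unfolding solves_ode_until_def by auto
    then have "(Z has_vector_derivative F (X n t)) (at t within {t. 0 \<le> t \<and> ereal t < ereal (real n)})"
      by (rule has_vector_derivative_transform[rotated 2]) (use Z t n in auto)
    moreover have "at t within {t. 0 \<le> t \<and> ereal t < ereal (real n)} = at t within {t. 0 \<le> t \<and> ereal t < \<infinity>}"
      by (rule at_within_nhd[where S = "{..<real n}"]) (use n in auto)
    ultimately show "(Z has_vector_derivative F (Z t)) (at t within {t. 0 \<le> t \<and> ereal t < \<infinity>})"
      using Z[OF t n] by simp
  qed
  then show ?thesis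
    unfolding trajectory_def assms(2) by (rule someI[of "solves_ode_until F x \<infinity>"])
qed

lemma solves_ode_until_infinity:
  "solves_ode_until F x \<infinity> X \<longleftrightarrow>
     X 0 = x \<and> (\<forall>t\<ge>0. (X has_vector_derivative F (X t)) (at t within {0..}))"
  by (auto simp: solves_ode_until_def atLeast_def)

lemma trajectory_eqI:
  fixes F :: "'a::euclidean_space \<Rightarrow> 'a"
  assumes "locally_lipschitz_on UNIV F" "t_max F x = \<infinity>" "solves_ode_until F x \<infinity> X" "0 \<le> t"
  shows "trajectory F x t = X t"
  using solves_ode_until_unique[OF assms(1) solves_ode_until_trajectory[OF assms(1,2)] assms(3,4)]
  by simp

text \<open>The equation is autonomous. Together with uniqueness this identifies the tail of a
  trajectory with the trajectory started at \<open>X t\<close>.\<close>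

lemma solves_ode_until_shift:
  assumes "solves_ode_until F x \<infinity> X" "0 \<le> t"
  shows "solves_ode_until F (X t) \<infinity> (\<lambda>s. X (t + s))"
  unfolding solves_ode_until_infinity
proof (intro conjI allI impI)
  fix s :: real assume s: "0 \<le> s"
  have "((+) t has_vector_derivative 1) (at s within {0..})"
    by (auto intro!: derivative_eq_intros)
  moreover have "(X has_vector_derivative F (X (t + s))) (at (t + s) within (+) t ` {0..})"
  proof (rule has_vector_derivative_within_subset)
    show "(X has_vector_derivative F (X (t + s))) (at (t + s) within {0..})"
      using assms s by (simp add: solves_ode_until_infinity)
  qed (use assms(2) in auto)
  ultimately have "((X \<circ> (+) t) has_vector_derivative 1 *\<^sub>R F (X (t + s))) (at s within {0..})"
    by (rule vector_diff_chain_within)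
  then show "((\<lambda>s. X (t + s)) has_vector_derivative F (X (t + s))) (at s within {0..})"
    by (simp add: o_def)
qed simp

subsection \<open>Lyapunov functions and the discounted cost\<close>

text \<open>The definite description in \<open>gradient\<close> is justified by representing the
  derivative as an inner product with a vector, built from its values on the basis; that vector is
  unique.\<close>

lemma GDERIV_gradient:
  fixes v :: "'a::euclidean_space \<Rightarrow> real"
  assumes "v differentiable (at x)"
  shows "GDERIV v x :> gradient v x"
proof -
  obtain v' where v': "(v has_derivative v') (at x)"
    using assms unfolding differentiable_def by blast
  interpret linear v' using v' by (rule has_derivative_linear)
  have "v' h = h \<bullet> (\<Sum>b\<in>Basis. v' b *\<^sub>R b)" for h
  proof -
    have "v' h = v' (\<Sum>b\<in>Basis. (h \<bullet> b) *\<^sub>R b)" by (simp add: euclidean_representation)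
    also have "\<dots> = (\<Sum>b\<in>Basis. (h \<bullet> b) * v' b)" by (simp add: sum scale)
    also have "\<dots> = h \<bullet> (\<Sum>b\<in>Basis. v' b *\<^sub>R b)"
      by (simp add: inner_sum_right mult.commute)
    finally show ?thesis .
  qed
  then have "v' = (\<lambda>h. h \<bullet> (\<Sum>b\<in>Basis. v' b *\<^sub>R b))" by blast
  then have D: "GDERIV v x :> (\<Sum>b\<in>Basis. v' b *\<^sub>R b)"
    using v' unfolding gderiv_def by simp
  have unique: "D = E" if "GDERIV v x :> D" "GDERIV v x :> E" for D E
  proof -
    have "(\<lambda>h. h \<bullet> D) = (\<lambda>h. h \<bullet> E)"
      using that unfolding gderiv_def by (rule has_derivative_unique)
    then show ?thesis by (metis vector_eq_ldot)
  qed
  show ?thesis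
    unfolding gradient_def by (rule theI, rule D, rule unique, assumption, rule D)
qed

lemma GDERIV_compose_curve:
  assumes "GDERIV J (X t) :> D" "(X has_vector_derivative w) (at t within S)"
  shows "((\<lambda>t. J (X t)) has_real_derivative w \<bullet> D) (at t within S)"
proof -
  have "((\<lambda>t. J (X t)) has_derivative (\<lambda>h. (h *\<^sub>R w) \<bullet> D)) (at t within S)"
    using assms has_derivative_compose unfolding gderiv_def has_vector_derivative_def by blast
  moreover have "(\<lambda>h. (h *\<^sub>R w) \<bullet> D) = (*) (w \<bullet> D)" by auto
  ultimately show ?thesis unfolding has_field_derivative_def by simp
qed

lemma GDERIV_continuous_on:
  assumes "\<And>x. GDERIV J x :> D x"
  shows "continuous_on S J"
  by (meson assms continuous_at_imp_continuous_on gderiv_def has_derivative_continuous)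

lemma DERIV_powr_exponent:
  assumes "(\<gamma>::real) > 0"
  shows "((\<lambda>t. \<gamma> powr t) has_real_derivative ln \<gamma> * \<gamma> powr t) (at t within S)"
  using assms unfolding powr_def by (auto intro!: derivative_eq_intros)

text \<open>The derivative of the left-hand side with respect to \<open>b\<close> is \<gamma> to the
  power \<open>b\<close> times the expression in \<open>ineq\<close>. The equation is required only
  on the open interval, so the bound also covers a curve up to its first exit from a ball.\<close>

lemma discounted_value_decreasing:
  fixes X :: "real \<Rightarrow> 'a::real_inner"
  assumes \<gamma>: "\<gamma> > 0" and J: "\<And>y. GDERIV J y :> D y"
    and ineq: "\<And>y. ln \<gamma> * J y + F y \<bullet> D y + C y \<le> 0"
    and C: "continuous_on UNIV C" and b: "0 \<le> b" and X: "continuous_on {0..b} X"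
    and X': "\<And>t. 0 < t \<Longrightarrow> t < b \<Longrightarrow> (X has_vector_derivative F (X t)) (at t)"
  shows "\<gamma> powr b * J (X b) + integral {0..b} (\<lambda>s. \<gamma> powr s * C (X s)) \<le> J (X 0)"
proof -
  define g where "g s = \<gamma> powr s * C (X s)" for s
  have g: "continuous_on {0..b} g"
    unfolding g_def using \<gamma>
    by (intro continuous_intros continuous_on_compose2[OF C] X) auto
  define \<psi> where "\<psi> t = \<gamma> powr t * J (X t) + integral {0..t} g" for t
  have "\<psi> 0 \<ge> \<psi> b"
  proof (rule DERIV_nonpos_imp_decreasing_open[OF b])
    show "continuous_on {0..b} \<psi>"
      unfolding \<psi>_def using \<gamma> g
      by (intro continuous_intros continuous_on_compose2[OF GDERIV_continuous_on[OF J]] X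
          indefinite_integral_continuous_1 integrable_continuous_real) auto
    fix t assume t: "0 < t" "t < b"
    have "((\<lambda>u. integral {0..u} g) has_vector_derivative g t) (at t within {0..b})"
      by (rule integral_has_vector_derivative[OF g]) (use t in auto)
    then have "((\<lambda>u. integral {0..u} g) has_real_derivative g t) (at t)"
      using t by (simp add: at_within_Icc_at has_real_derivative_iff_has_vector_derivative)
    then have "(\<psi> has_real_derivative
        ln \<gamma> * \<gamma> powr t * J (X t) + F (X t) \<bullet> D (X t) * \<gamma> powr t + g t) (at t)"
      unfolding \<psi>_def
      by (intro DERIV_add DERIV_mult DERIV_powr_exponent GDERIV_compose_curve J \<gamma> X' t)
    moreover have "ln \<gamma> * \<gamma> powr t * J (X t) + F (X t) \<bullet> D (X t) * \<gamma> powr t + g t =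
        \<gamma> powr t * (ln \<gamma> * J (X t) + F (X t) \<bullet> D (X t) + C (X t))"
      by (simp add: g_def algebra_simps)
    ultimately show "\<exists>y. DERIV \<psi> t :> y \<and> y \<le> 0"
      using ineq[of "X t"] by (metis mult_nonneg_nonpos powr_ge_zero)
  qed
  then show ?thesis using \<gamma> by (simp add: \<psi>_def g_def[abs_def])
qed

section \<open>Nonnegative integrals over the half-line\<close>

lemma borel_measurable_ennreal_indicator_atLeast:
  assumes "continuous_on {0..} (g :: real \<Rightarrow> real)"
  shows "(\<lambda>s. ennreal (g s) * indicator {0..} s) \<in> borel_measurable borel"
proof -
  have "(\<lambda>s. ennreal (indicator {0..} s *\<^sub>R g s)) \<in> borel_measurable borel"
    using borel_measurable_continuous_on_indicator[OF _ assms] by measurable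
  also have "(\<lambda>s. ennreal (indicator {0..} s *\<^sub>R g s)) = (\<lambda>s. ennreal (g s) * indicator {0..} s)"
    by (auto simp: indicator_def)
  finally show ?thesis .
qed

lemma nn_integral_Icc_eq_integral:
  fixes g :: "real \<Rightarrow> real"
  assumes "continuous_on {0..} g" "\<And>s. 0 \<le> s \<Longrightarrow> 0 \<le> g s"
  shows "(\<integral>\<^sup>+s\<in>{0..b}. ennreal (g s) \<partial>lborel) = ennreal (integral {0..b} g)"
proof (rule nn_integral_has_integral_lebesgue')
  show "(g has_integral integral {0..b} g) {0..b}"
    by (intro integrable_integral integrable_continuous_real continuous_on_subset[OF assms(1)]) auto
qed (use assms in auto)

text \<open>Monotone convergence along the intervals \<open>{0..real n}\<close> carries a uniform
  bound on finite-horizon costs over to the infinite horizon.\<close>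

lemma nn_integral_atLeast_le:
  fixes g :: "real \<Rightarrow> real"
  assumes cont: "continuous_on {0..} g" and nonneg: "\<And>s. 0 \<le> s \<Longrightarrow> 0 \<le> g s"
    and bound: "\<And>b. 0 \<le> b \<Longrightarrow> integral {0..b} g \<le> B"
  shows "(\<integral>\<^sup>+s\<in>{0..}. ennreal (g s) \<partial>lborel) \<le> ennreal B"
proof -
  let ?h = "\<lambda>(n::nat) s. ennreal (g s) * indicator {0..real n} s"
  have incseq: "incseq ?h"
    by (auto simp: incseq_def le_fun_def split: split_indicator)
  have "(SUP n. ?h n s) = ennreal (g s) * indicator {0..} s" for s
  proof (rule LIMSEQ_unique[OF LIMSEQ_SUP])
    obtain n where "s < real n" using reals_Archimedean2 by blast
    then have "eventually (\<lambda>n. ?h n s = ennreal (g s) * indicator {0..} s) sequentially"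
      by (intro eventually_sequentiallyI[where c = n]) (auto split: split_indicator)
    then show "(\<lambda>n. ?h n s) \<longlonglongrightarrow> ennreal (g s) * indicator {0..} s"
      by (rule tendsto_eventually)
  qed (use incseq in \<open>auto simp: incseq_def le_fun_def\<close>)
  then have "(\<integral>\<^sup>+s\<in>{0..}. ennreal (g s) \<partial>lborel) = (\<integral>\<^sup>+s. (SUP n. ?h n s) \<partial>lborel)" by simp
  also have "\<dots> = (SUP n. \<integral>\<^sup>+s. ?h n s \<partial>lborel)"
  proof (rule nn_integral_monotone_convergence_SUP[OF incseq])
    fix n
    have "(\<lambda>s. (ennreal (g s) * indicator {0..} s) * indicator {0..real n} s) \<in> borel_measurable borel"
      using borel_measurable_ennreal_indicator_atLeast[OF cont] by measurable
    also have "(\<lambda>s. (ennreal (g s) * indicator {0..} s) * indicator {0..real n} s) = ?h n"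
      by (auto simp: indicator_def)
    finally show "?h n \<in> borel_measurable lborel" by simp
  qed
  also have "\<dots> \<le> ennreal B"
    using bound by (intro SUP_least) (simp add: nn_integral_Icc_eq_integral[OF cont nonneg] ennreal_leI)
  finally show ?thesis .
qed

lemma nn_integral_atLeast_shift:
  fixes g :: "real \<Rightarrow> real"
  assumes cont: "continuous_on {0..} g" and nonneg: "\<And>s. 0 \<le> s \<Longrightarrow> 0 \<le> g s" and t: "0 \<le> t"
  shows "(\<integral>\<^sup>+s\<in>{0..}. ennreal (g s) \<partial>lborel) =
    ennreal (integral {0..t} g) + (\<integral>\<^sup>+s\<in>{0..}. ennreal (g (t + s)) \<partial>lborel)"
proof -
  let ?G = "\<lambda>s. ennreal (g s) * indicator {0..} s"
  note [measurable] = borel_measurable_ennreal_indicator_atLeast[OF cont]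
  have "(\<integral>\<^sup>+s. ?G s \<partial>lborel) =
      (\<integral>\<^sup>+s. ?G s * indicator {..t} s + ?G s * indicator {t<..} s \<partial>lborel)"
    by (intro nn_integral_cong) (auto split: split_indicator)
  also have "\<dots> = (\<integral>\<^sup>+s. ?G s * indicator {..t} s \<partial>lborel) + (\<integral>\<^sup>+s. ?G s * indicator {t<..} s \<partial>lborel)"
    by (rule nn_integral_add) measurable
  also have "(\<integral>\<^sup>+s. ?G s * indicator {..t} s \<partial>lborel) = (\<integral>\<^sup>+s\<in>{0..t}. ennreal (g s) \<partial>lborel)"
    by (intro nn_integral_cong) (auto split: split_indicator)
  also have "\<dots> = ennreal (integral {0..t} g)"
    by (rule nn_integral_Icc_eq_integral[OF cont nonneg])
  also have "(\<integral>\<^sup>+s. ?G s * indicator {t<..} s \<partial>lborel) =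
      (\<integral>\<^sup>+s. ?G (t + 1 * s) * indicator {t<..} (t + 1 * s) \<partial>lborel)"
    using nn_integral_real_affine[of "\<lambda>s. ?G s * indicator {t<..} s" 1 t] by simp
  \<comment> \<open>The shifted integrand is restricted to \<open>s > 0\<close>; the missing point
    \<open>0\<close> is a null set.\<close>
  also have "\<dots> = (\<integral>\<^sup>+s\<in>{0..}. ennreal (g (t + s)) \<partial>lborel)"
    using AE_lborel_singleton[of 0]
    by (intro nn_integral_cong_AE) (use t in \<open>auto split: split_indicator\<close>)
  finally show ?thesis .
qed

section \<open>Exclusion of blow-up\<close>

lemma radially_unboundedD:
  fixes g :: "'a::real_normed_vector \<Rightarrow> real"
  assumes "radially_unbounded g"
  obtains R where "R > 0" "\<And>x. norm x \<ge> R \<Longrightarrow> \<bar>g x\<bar> > M"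
proof -
  have "eventually (\<lambda>\<rho>. (INF x\<in>{x. norm x \<ge> \<rho>}. \<bar>g x\<bar>) > M) at_top"
    using assms unfolding radially_unbounded_def filterlim_at_top_dense by blast
  then obtain R0 where R0: "\<And>\<rho>. \<rho> \<ge> R0 \<Longrightarrow> (INF x\<in>{x. norm x \<ge> \<rho>}. \<bar>g x\<bar>) > M"
    unfolding eventually_at_top_linorder by blast
  show thesis
  proof (rule that[of "max R0 1"])
    fix x :: 'a assume "norm x \<ge> max R0 1"
    then have "(INF x\<in>{x. norm x \<ge> max R0 1}. \<bar>g x\<bar>) \<le> \<bar>g x\<bar>"
      by (intro cINF_lower bdd_belowI[of _ 0]) auto
    with R0[of "max R0 1"] show "\<bar>g x\<bar> > M" by simp
  qed simp
qed

text \<open>Along a solution \<open>J\<close> is at most \<open>J x / \<gamma> powr t\<close>, which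
  is bounded on \<open>{0..T}\<close>. Radial unboundedness then confines the truncated solution to
  a ball where it solves the original equation, and \<open>T\<close> is arbitrary.\<close>

lemma t_max_infinityI:
  fixes F :: "'a::euclidean_space \<Rightarrow> 'a"
  assumes lip: "locally_lipschitz_on UNIV F" and \<gamma>: "\<gamma> > 0" and J: "\<And>y. GDERIV J y :> D y"
    and J_nonneg: "\<And>y. 0 \<le> J y" and unbounded: "radially_unbounded J"
    and decr: "\<And>y. ln \<gamma> * J y + F y \<bullet> D y \<le> 0"
  shows "t_max F x = \<infinity>"
proof -
  have "ereal T \<le> t_max F x" if T: "T > 0" for T
  proof -
    obtain M where M: "\<And>t. t \<in> {0..T} \<Longrightarrow> J x / \<gamma> powr t \<le> M"
    proof -
      have "continuous_on {0..T} (\<lambda>t. J x / \<gamma> powr t)"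
        using \<gamma> by (intro continuous_intros) auto
      then have "bounded ((\<lambda>t. J x / \<gamma> powr t) ` {0..T})"
        by (intro compact_imp_bounded compact_continuous_image) auto
      then show thesis
        using that unfolding bounded_real by (metis abs_le_D1 imageI)
    qed
    obtain R0 where R0: "R0 > 0" "\<And>y. norm y \<ge> R0 \<Longrightarrow> \<bar>J y\<bar> > M"
      using radially_unboundedD[OF unbounded] by blast
    obtain Y where Y: "Y 0 = x" "continuous_on {0..} Y"
      "\<And>t. t \<ge> 0 \<Longrightarrow> norm (Y t) \<le> R0 \<Longrightarrow> (Y has_vector_derivative F (Y t)) (at t within {0..})"
      using truncated_solution[OF lip R0(1)] by blast
    have inside: "norm (Y t) < R0" if t: "0 \<le> t" "t \<le> T" for t
    proof (rule ccontr)
      assume "\<not> norm (Y t) < R0"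
      \<comment> \<open>The set of times at which the truncated curve is not strictly inside the
        ball. It is compact, so there is a first such time \<tau>.\<close>
      define S where "S = {0..T} \<inter> (\<lambda>s. norm (Y s)) -` {R0..}"
      have "closed S"
        unfolding S_def
        by (intro continuous_closed_preimage continuous_intros continuous_on_subset[OF Y(2)]) auto
      then have "compact ({0..T} \<inter> S)" by (intro compact_Int_closed) auto
      then have "compact S" by (simp add: S_def)
      moreover have "t \<in> S" using t \<open>\<not> norm (Y t) < R0\<close> by (simp add: S_def)
      ultimately obtain \<tau> where \<tau>: "\<tau> \<in> S" "\<And>s. s \<in> S \<Longrightarrow> \<tau> \<le> s"
        using compact_attains_inf[of S] by blast
      then have \<tau>T: "0 \<le> \<tau>" "\<tau> \<le> T" "R0 \<le> norm (Y \<tau>)" by (auto simp: S_def)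
      \<comment> \<open>Before \<tau> the curve obeys the original equation, so the decrease applies
        with running cost zero. It bounds \<open>J (Y \<tau>)\<close> by \<open>M\<close>, against
        the choice of \<open>R0\<close>.\<close>
      have "\<gamma> powr \<tau> * J (Y \<tau>) + integral {0..\<tau>} (\<lambda>s. \<gamma> powr s * 0) \<le> J (Y 0)"
      proof (rule discounted_value_decreasing[OF \<gamma> J _ _ \<tau>T(1)])
        show "continuous_on {0..\<tau>} Y" using Y(2) by (rule continuous_on_subset) auto
        show "ln \<gamma> * J y + F y \<bullet> D y + 0 \<le> 0" for y using decr by simp
        fix s assume s: "0 < s" "s < \<tau>"
        then have "s \<notin> S" using \<tau>(2) by fastforce
        then have "norm (Y s) \<le> R0" using s \<tau>T by (simp add: S_def)
        then have "(Y has_vector_derivative F (Y s)) (at s within {0..})" using Y(3) s by simp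
        then show "(Y has_vector_derivative F (Y s)) (at s)"
          using at_within_interior[of s "{0..}"] s by simp
      qed simp
      then have "J (Y \<tau>) \<le> J x / \<gamma> powr \<tau>"
        using \<gamma> Y(1) by (simp add: pos_le_divide_eq mult.commute)
      also have "\<dots> \<le> M" using M \<tau>T by simp
      also have "\<dots> < J (Y \<tau>)" using R0(2)[OF \<tau>T(3)] J_nonneg by simp
      finally show False by simp
    qed
    have "solves_ode_until F x (ereal T) Y"
      unfolding solves_ode_until_def
    proof (intro conjI ballI)
      fix t assume "t \<in> {t. 0 \<le> t \<and> ereal t < ereal T}"
      then have "(Y has_vector_derivative F (Y t)) (at t within {0..})"
        using Y(3) inside by (simp add: less_imp_le)
      then show "(Y has_vector_derivative F (Y t)) (at t within {t. 0 \<le> t \<and> ereal t < ereal T})"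
        by (rule has_vector_derivative_within_subset) auto
    qed (rule Y(1))
    with T show ?thesis unfolding t_max_def by (intro Sup_upper) auto
  qed
  then have "ereal B \<le> t_max F x" for B
    by (cases "B > 0") (auto intro: order_trans[of _ "ereal 1"])
  then show ?thesis by (rule ereal_top)
qed


section \<open>The cost along trajectories\<close>

lemma cost_value_finite:
  assumes "cost_value f c \<gamma> \<pi> x < \<infinity>"
  shows "t_max (\<lambda>y. f y (\<pi> y)) x = \<infinity>"
    and "cost_value f c \<gamma> \<pi> x = (\<integral>\<^sup>+t\<in>{0..}. ennreal (\<gamma> powr t *
      c (trajectory (\<lambda>y. f y (\<pi> y)) x t) (\<pi> (trajectory (\<lambda>y. f y (\<pi> y)) x t))) \<partial>lborel)"
  using assms by (auto simp: cost_value_def Let_def split: if_splits)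

text \<open>The dynamic programming identity. Splitting the cost integral at \<open>t\<close> leaves
  a tail that, up to the factor \<open>\<gamma> powr t\<close>, is the cost from \<open>X t\<close>.
  Finiteness of the cost allows passing to real numbers.\<close>

lemma cost_value_along_trajectory:
  fixes f :: "'a::euclidean_space \<Rightarrow> 'b \<Rightarrow> 'a"
  assumes F_def: "F = (\<lambda>y. f y (\<pi> y))"
    and lip: "locally_lipschitz_on UNIV F" and C: "continuous_on UNIV (\<lambda>y. c y (\<pi> y))"
    and nonneg: "\<And>y. 0 \<le> c y (\<pi> y)" and \<gamma>: "\<gamma> > 0"
    and fin: "\<And>y. cost_value f c \<gamma> \<pi> y < \<infinity>"
    and X: "solves_ode_until F x \<infinity> X" and t: "0 \<le> t"
  shows "enn2real (cost_value f c \<gamma> \<pi> x) =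
    integral {0..t} (\<lambda>s. \<gamma> powr s * c (X s) (\<pi> (X s))) + \<gamma> powr t * enn2real (cost_value f c \<gamma> \<pi> (X t))"
proof -
  \<comment> \<open>By uniqueness the cost may be computed along any global solution, not just the
    one selected by \<open>trajectory\<close>; this is needed for the shifted curve.\<close>
  have cost: "cost_value f c \<gamma> \<pi> y = (\<integral>\<^sup>+s\<in>{0..}. ennreal (\<gamma> powr s * c (Z s) (\<pi> (Z s))) \<partial>lborel)"
    if Z: "solves_ode_until F y \<infinity> Z" for y Z
    unfolding cost_value_finite(2)[OF fin[of y]] F_def[symmetric]
    by (intro nn_integral_cong)
      (use trajectory_eqI[OF lip _ Z] cost_value_finite(1)[OF fin[of y]] in
        \<open>auto simp: F_def split: split_indicator\<close>)
  define g where "g s = \<gamma> powr s * c (X s) (\<pi> (X s))" for s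
  have "continuous_on {0..} X"
    using solves_ode_until_continuous_on[OF X] by (simp add: atLeast_def)
  then have g: "continuous_on {0..} g" "\<And>s. 0 \<le> g s"
    unfolding g_def using \<gamma> nonneg
    by (auto intro!: continuous_intros continuous_on_compose2[OF C])
  have "(\<integral>\<^sup>+s\<in>{0..}. ennreal (g (t + s)) \<partial>lborel) =
      (\<integral>\<^sup>+s. ennreal (\<gamma> powr t) * (ennreal (\<gamma> powr s * c (X (t + s)) (\<pi> (X (t + s)))) * indicator {0..} s) \<partial>lborel)"
    by (intro nn_integral_cong)
      (auto simp: g_def powr_add mult.assoc nonneg simp flip: ennreal_mult split: split_indicator)
  also have "\<dots> = ennreal (\<gamma> powr t) * cost_value f c \<gamma> \<pi> (X t)"
    unfolding cost[OF solves_ode_until_shift[OF X t]]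
  proof (rule nn_integral_cmult)
    have "continuous_on {0..} (\<lambda>s. \<gamma> powr s * c (X (t + s)) (\<pi> (X (t + s))))"
      using \<gamma> solves_ode_until_continuous_on[OF solves_ode_until_shift[OF X t]]
      by (intro continuous_intros continuous_on_compose2[OF C]) (auto simp: atLeast_def)
    from borel_measurable_ennreal_indicator_atLeast[OF this]
    show "(\<lambda>s. ennreal (\<gamma> powr s * c (X (t + s)) (\<pi> (X (t + s)))) * indicator {0..} s) \<in> borel_measurable lborel"
      by simp
  qed
  finally have "cost_value f c \<gamma> \<pi> x =
      ennreal (integral {0..t} g) + ennreal (\<gamma> powr t) * cost_value f c \<gamma> \<pi> (X t)"
    using nn_integral_atLeast_shift[OF g t] cost[OF X] by (simp add: g_def[abs_def])
  moreover have "integral {0..t} g \<ge> 0"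
    using g by (intro integral_nonneg integrable_continuous_real) (auto intro: continuous_on_subset)
  ultimately show ?thesis
    using fin[of "X t"] by (simp add: g_def[abs_def] enn2real_plus enn2real_mult ennreal_mult_less_top)
qed

text \<open>The Hamilton--Jacobi--Bellman equation of a fixed policy: differentiate the preceding
  identity at time zero.\<close>

lemma cost_value_gradient:
  fixes f :: "'a::euclidean_space \<Rightarrow> 'b \<Rightarrow> 'a"
  assumes F_def: "F = (\<lambda>y. f y (\<pi> y))" and J_def: "J = (\<lambda>x. enn2real (cost_value f c \<gamma> \<pi> x))"
    and lip: "locally_lipschitz_on UNIV F" and C: "continuous_on UNIV (\<lambda>y. c y (\<pi> y))"
    and nonneg: "\<And>y. 0 \<le> c y (\<pi> y)" and \<gamma>: "\<gamma> > 0"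
    and fin: "\<And>y. cost_value f c \<gamma> \<pi> y < \<infinity>" and D: "GDERIV (J) x :> D"
  shows "ln \<gamma> * J x + F x \<bullet> D + c x (\<pi> x) = 0"
proof -
  define X where "X = trajectory F x"
  have X: "solves_ode_until F x \<infinity> X"
    unfolding X_def using solves_ode_until_trajectory[OF lip] cost_value_finite(1)[OF fin] F_def by metis
  then have X0: "X 0 = x" and X': "(X has_vector_derivative F x) (at 0 within {0..})"
    by (auto simp: solves_ode_until_infinity)
  define g where "g s = \<gamma> powr s * c (X s) (\<pi> (X s))" for s
  have "continuous_on {0..} X"
    using solves_ode_until_continuous_on[OF X] by (simp add: atLeast_def)
  then have g: "continuous_on {0..} g"
    unfolding g_def using \<gamma> by (auto intro!: continuous_intros continuous_on_compose2[OF C])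
  define \<psi> where "\<psi> t = \<gamma> powr t * J (X t) + integral {0..t} g" for t
  have "(\<psi> has_real_derivative ln \<gamma> * \<gamma> powr 0 * J (X 0) + F x \<bullet> D * \<gamma> powr 0 + g 0) (at 0 within {0..})"
    unfolding \<psi>_def
    by (intro DERIV_add DERIV_mult DERIV_powr_exponent GDERIV_compose_curve \<gamma> X')
      (use D X0 integral_has_vector_derivative_atLeast[OF g, of 0] in
        \<open>auto simp: has_real_derivative_iff_has_vector_derivative\<close>)
  \<comment> \<open>By the dynamic programming identity \<psi> is constantly \<open>J x\<close> on
    \<open>{0..}\<close>.\<close>
  moreover have "(\<psi> has_real_derivative 0) (at 0 within {0..})"
  proof (rule has_field_derivative_transform_within[of "\<lambda>_. J x" _ _ _ 1])
    show "J x = \<psi> t" if "t \<in> {0..}" for t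
      using cost_value_along_trajectory[OF F_def lip C nonneg \<gamma> fin X, of t] that
      by (simp add: \<psi>_def g_def[abs_def] J_def)
  qed auto
  \<comment> \<open>Two derivatives within \<open>{0..}\<close> at \<open>0\<close> must coincide
    because \<open>0\<close> is not isolated there.\<close>
  moreover have "at (0::real) within {0..} \<noteq> bot"
  proof -
    have "at_right (0::real) \<le> at 0 within {0..}" by (rule at_le) auto
    then show ?thesis by (metis bot_unique trivial_limit_at_right_real)
  qed
  ultimately have "ln \<gamma> * \<gamma> powr 0 * J (X 0) + F x \<bullet> D * \<gamma> powr 0 + g 0 = 0"
    by (rule has_field_derivative_unique)
  then show ?thesis using \<gamma> X0 by (simp add: g_def)
qed

text \<open>A verification argument: a nonnegative, radially unbounded \<open>J\<close> satisfying
  the Bellman inequality forces global existence. Discarding the nonnegative terminal term then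
  bounds every finite-horizon cost by \<open>J x\<close>.\<close>

lemma cost_value_le:
  fixes f :: "'a::euclidean_space \<Rightarrow> 'b \<Rightarrow> 'a"
  assumes F_def: "F = (\<lambda>y. f y (\<pi> y))"
    and lip: "locally_lipschitz_on UNIV F" and C: "continuous_on UNIV (\<lambda>y. c y (\<pi> y))"
    and nonneg: "\<And>y. 0 \<le> c y (\<pi> y)" and \<gamma>: "\<gamma> > 0"
    and J: "\<And>y. GDERIV J y :> D y" and J_nonneg: "\<And>y. 0 \<le> J y" and unbounded: "radially_unbounded J"
    and ineq: "\<And>y. ln \<gamma> * J y + F y \<bullet> D y + c y (\<pi> y) \<le> 0"
  shows "cost_value f c \<gamma> \<pi> x \<le> ennreal (J x)"
proof -
  have t_max: "t_max F x = \<infinity>"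
  proof (rule t_max_infinityI[OF lip \<gamma> J J_nonneg unbounded])
    show "ln \<gamma> * J y + F y \<bullet> D y \<le> 0" for y using ineq[of y] nonneg[of y] by linarith
  qed
  define X where "X = trajectory F x"
  have X: "solves_ode_until F x \<infinity> X"
    unfolding X_def by (rule solves_ode_until_trajectory[OF lip t_max])
  have X_cont: "continuous_on {0..} X"
    using solves_ode_until_continuous_on[OF X] by (simp add: atLeast_def)
  have "(\<integral>\<^sup>+t\<in>{0..}. ennreal (\<gamma> powr t * c (X t) (\<pi> (X t))) \<partial>lborel) \<le> ennreal (J x)"
  proof (rule nn_integral_atLeast_le)
    show "continuous_on {0..} (\<lambda>t. \<gamma> powr t * c (X t) (\<pi> (X t)))"
      using \<gamma> X_cont by (intro continuous_intros continuous_on_compose2[OF C]) auto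
    fix b :: real assume b: "0 \<le> b"
    have "\<gamma> powr b * J (X b) + integral {0..b} (\<lambda>t. \<gamma> powr t * c (X t) (\<pi> (X t))) \<le> J (X 0)"
    proof (rule discounted_value_decreasing[OF \<gamma> J ineq C b])
      show "continuous_on {0..b} X" using X_cont by (rule continuous_on_subset) auto
      show "(X has_vector_derivative F (X t)) (at t)" if "0 < t" for t
        using solves_ode_until_at[OF X that] by simp
    qed
    moreover have "\<gamma> powr b * J (X b) \<ge> 0" using J_nonneg by simp
    moreover have "X 0 = x" using X by (simp add: solves_ode_until_infinity)
    ultimately show "integral {0..b} (\<lambda>t. \<gamma> powr t * c (X t) (\<pi> (X t))) \<le> J x" by simp
  qed (simp add: nonneg)
  then show ?thesis
    using t_max by (simp add: cost_value_def Let_def X_def F_def)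
qed

subsection \<open>Policy improvement\<close>

theorem theorem5p18:
  fixes U :: "(real ^ 'm) set"
    and f :: "real ^ 'l \<Rightarrow> real ^ 'm \<Rightarrow> real ^ 'l"
    and c :: "real ^ 'l \<Rightarrow> real ^ 'm \<Rightarrow> real"
    and \<gamma> :: real
    and ustar :: "real ^ 'l \<Rightarrow> real ^ 'l \<Rightarrow> real ^ 'm"
    and \<pi> \<pi>' :: "real ^ 'l \<Rightarrow> real ^ 'm"
  assumes U_shape: "\<exists>O'. open O' \<and> (U = O' \<union> frontier O' \<or> U = O')"
    and U_zero: "0 \<in> U"
    and f_lipschitz: "locally_lipschitz_on (UNIV \<times> U) (\<lambda>(x, u). f x u)"
    and f_zero: "f 0 0 = 0"
    and c_continuous: "continuous_on (UNIV \<times> U) (\<lambda>(x, u). c x u)"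
    and c_zero: "c 0 0 = 0"
    and c_pos: "\<And>x u. u \<in> U \<Longrightarrow> (x, u) \<noteq> (0, 0) \<Longrightarrow> c x u > 0"
    and \<gamma>_range: "\<gamma> \<in> {0<..1}"
    and ustar_lipschitz: "locally_lipschitz_on UNIV (\<lambda>(x, p). ustar x p)"
    and ustar_argmax: "\<And>x p. is_arg_max (\<lambda>u. hamiltonian f c x u p) (\<lambda>u. u \<in> U) (ustar x p)"
    and admissible_nonempty: "admissible U f c \<gamma> \<noteq> {}"
    and value_C1: "\<And>\<mu>. \<mu> \<in> admissible U f c \<gamma> \<Longrightarrow> C1_lipschitz_gradient (value_fun f c \<gamma> \<mu>)"
    and cost_nonvanishing: "\<And>\<mu>. \<mu> \<in> policies0 U \<Longrightarrow> radially_nonvanishing (\<lambda>x. c x (\<mu> x))"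
    and \<pi>_admissible: "\<pi> \<in> admissible U f c \<gamma>"
    and J_unbounded: "radially_unbounded (\<lambda>x. enn2real (cost_value f c \<gamma> \<pi> x))"
    and \<pi>'_def: "\<And>x. \<pi>' x = ustar x (gradient (value_fun f c \<gamma> \<pi>) x)"
  shows "\<pi>' \<in> admissible U f c \<gamma> \<and>
         (\<forall>x. cost_value f c \<gamma> \<pi>' x \<le> cost_value f c \<gamma> \<pi> x)"
proof -
  have \<gamma>: "\<gamma> > 0" using \<gamma>_range by simp
  define J where "J x = enn2real (cost_value f c \<gamma> \<pi> x)" for x
  define v where "v = value_fun f c \<gamma> \<pi>"
  \<comment> \<open>As \<open>v\<close> is the negative of \<open>J\<close>, this is the gradient of
    \<open>J\<close>.\<close>
  define D where "D x = - gradient v x" for x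
  have v_eq: "v = (\<lambda>x. - J x)" by (auto simp: v_def value_fun_def J_def)
  have fin: "cost_value f c \<gamma> \<pi> x < \<infinity>" for x
    using \<pi>_admissible by (simp add: admissible_def)
  have cost_J: "cost_value f c \<gamma> \<pi> x = ennreal (J x)" for x
    using fin[of x] by (simp add: J_def)
  have v: "C1_lipschitz_gradient v" unfolding v_def by (rule value_C1[OF \<pi>_admissible])
  then have v': "GDERIV v x :> gradient v x" for x
    by (intro GDERIV_gradient) (simp add: C1_lipschitz_gradient_def)
  have J': "GDERIV J x :> D x" for x
    using GDERIV_minus[OF v'[of x]] by (simp add: v_eq D_def)
  have c_nonneg: "0 \<le> c x u" if "u \<in> U" for x u
    using c_pos[OF that, of x] c_zero by (cases "(x, u) = (0, 0)") (auto simp: less_imp_le)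

  have closed_loop: "locally_lipschitz_on UNIV (\<lambda>x. f x (\<mu> x))" "continuous_on UNIV (\<lambda>x. c x (\<mu> x))"
    if \<mu>: "locally_lipschitz_on UNIV \<mu>" "range \<mu> \<subseteq> U" for \<mu>
  proof -
    note graph = locally_lipschitz_on_graph[OF \<mu>(1)]
    show "locally_lipschitz_on UNIV (\<lambda>x. f x (\<mu> x))"
      using locally_lipschitz_on_compose[OF graph f_lipschitz] \<mu>(2) by force
    show "continuous_on UNIV (\<lambda>x. c x (\<mu> x))"
      using continuous_on_compose2[OF c_continuous locally_lipschitz_on_imp_continuous_on[OF graph]] \<mu>(2)
      by force
  qed

  have \<pi>: "locally_lipschitz_on UNIV \<pi>" "range \<pi> \<subseteq> U" "\<pi> 0 = 0"
    using \<pi>_admissible by (auto simp: admissible_def policies0_def policies_def)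
  then have \<pi>U: "\<pi> x \<in> U" for x by auto
  have \<pi>'_eq: "\<pi>' x = ustar x (gradient v x)" for x by (simp add: \<pi>'_def v_def)
  have ustar_U: "ustar x p \<in> U" for x p
    using ustar_argmax[of x p] by (simp add: is_arg_max_def)
  have \<pi>'U: "\<pi>' x \<in> U" for x by (simp add: \<pi>'_eq ustar_U)
  then have \<pi>'_range: "range \<pi>' \<subseteq> U" by blast
  have ustar_max: "hamiltonian f c x u p \<le> hamiltonian f c x (ustar x p) p" if "u \<in> U" for x u p
    using ustar_argmax[of x p] that by (force simp: is_arg_max_def)

  have "locally_lipschitz_on UNIV (\<lambda>x. case (x, gradient v x) of (x, p) \<Rightarrow> ustar x p)"
    by (rule locally_lipschitz_on_compose[OF locally_lipschitz_on_graph ustar_lipschitz])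
      (use v in \<open>auto simp: C1_lipschitz_gradient_def\<close>)
  moreover have "\<pi>' = (\<lambda>x. case (x, gradient v x) of (x, p) \<Rightarrow> ustar x p)"
    by (auto simp: \<pi>'_eq)
  ultimately have \<pi>'_lip: "locally_lipschitz_on UNIV \<pi>'" by simp

  \<comment> \<open>This serves to show \<open>\<pi>' 0 = 0\<close>. The origin is an equilibrium of
    the closed loop of \<pi> with zero running cost, so \<open>J\<close> attains its minimum there
    and its gradient vanishes.\<close>
  have "J 0 = 0"
  proof -
    have loop: "locally_lipschitz_on UNIV (\<lambda>x. f x (\<pi> x))" by (rule closed_loop(1)[OF \<pi>(1,2)])
    have "solves_ode_until (\<lambda>x. f x (\<pi> x)) 0 \<infinity> (\<lambda>_. 0)"
      using f_zero \<pi>(3) by (simp add: solves_ode_until_def)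
    then have zero: "trajectory (\<lambda>x. f x (\<pi> x)) 0 t = 0" if "0 \<le> t" for t
      using trajectory_eqI[OF loop cost_value_finite(1)[OF fin]] that by blast
    have "cost_value f c \<gamma> \<pi> 0 = integral\<^sup>N (lborel :: real measure) (\<lambda>_. 0)"
      unfolding cost_value_finite(2)[OF fin]
      by (intro nn_integral_cong) (auto simp: zero \<pi>(3) c_zero split: split_indicator)
    then show ?thesis by (simp add: J_def)
  qed
  then have "(\<lambda>h. h \<bullet> D 0) = (\<lambda>_. 0)"
    using J'[of 0] unfolding gderiv_def
    by (intro differential_zero_maxmin[of 0 UNIV J]) (auto simp: J_def)
  then have "gradient v 0 = 0" by (metis D_def inner_eq_zero_iff neg_equal_0_iff_equal)
  \<comment> \<open>With \<open>p = 0\<close> the Hamiltonian at the origin reduces to the negative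
    cost, and comparison with the action \<open>0\<close> leaves no positive cost for
    \<open>\<pi>' 0\<close>; positive definiteness then gives \<open>\<pi>' 0 = 0\<close>.\<close>
  then have "c 0 (\<pi>' 0) \<le> 0"
    using ustar_max[OF U_zero, of 0 0] c_zero by (simp add: hamiltonian_def \<pi>'_eq)
  then have \<pi>'_zero: "\<pi>' 0 = 0" using c_pos[OF \<pi>'U, of 0 0] by fastforce

  have le: "cost_value f c \<gamma> \<pi>' x \<le> cost_value f c \<gamma> \<pi> x" for x
    unfolding cost_J
  proof (rule cost_value_le[where J = J and f = f and c = c and \<pi> = \<pi>' and D = D,
      OF refl closed_loop[OF \<pi>'_lip \<pi>'_range] _ \<gamma> J'])
    show "0 \<le> c y (\<pi>' y)" "0 \<le> J y" for y
      using \<pi>'U c_nonneg by (auto simp: J_def)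
    show "radially_unbounded J" using J_unbounded by (simp add: J_def[abs_def])
    fix y
    have "ln \<gamma> * J y + f y (\<pi> y) \<bullet> D y + c y (\<pi> y) = 0"
    proof (rule cost_value_gradient[where J = J and f = f and c = c and \<pi> = \<pi> and D = "D y",
        OF refl _ closed_loop[OF \<pi>(1,2)] _ \<gamma> fin J'])
      show "J = (\<lambda>x. enn2real (cost_value f c \<gamma> \<pi> x))" by (simp add: J_def[abs_def])
    qed (simp add: c_nonneg \<pi>U)
    \<comment> \<open>Since \<open>D y\<close> is the negative of \<open>gradient v y\<close>, the
      last two summands are minus the Hamiltonian. Maximality of the action \<open>\<pi>' y\<close>
      thus makes the sum at most its value for \<open>\<pi> y\<close>, which is zero.\<close>
    then show "ln \<gamma> * J y + f y (\<pi>' y) \<bullet> D y + c y (\<pi>' y) \<le> 0"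
      using ustar_max[OF \<pi>U[of y], of y "gradient v y"]
      by (simp add: hamiltonian_def \<pi>'_eq D_def inner_commute)
  qed
  \<comment> \<open>Finiteness of the cost of \<open>\<pi>'\<close> is inherited from \<pi> through
    \<open>le\<close>.\<close>
  moreover have "\<pi>' \<in> admissible U f c \<gamma>"
    using le_less_trans[OF le fin] \<pi>'_lip \<pi>'_range \<pi>'_zero
    by (auto simp: admissible_def policies0_def policies_def
        intro: locally_lipschitz_on_imp_continuous_on)
  ultimately show ?thesis by blast
qed

end
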